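(* Let $\mathrm{Cat}=\mathcal{R}(C(t),tC(t))$. Then $$\mathrm{Der}(\mathrm{Cat})=\mathcal{R}\Big(\frac{1}{\sqrt{1-4t}},\frac{1-\sqrt{1-4t}}{2}\Big),\qquad (\mathrm{Der}(\mathrm{Cat}))^{-1}=\mathcal{R}(1-2t,\,t-t^2),$$ and for all $n\ge k\ge0$ the $(n,k)$-entry of $\mathrm{Der}(\mathrm{Cat})$ is $\binom{2n-k}{n-k}$.
   Context: $C(t)=\sum_{n\ge0}C_nt^n=\frac{1-\sqrt{1-4t}}{2t}$ is the Catalan generating function, $C_n=\frac{1}{n+1}\binom{2n}{n}$. For formal power series $d(t),h(t)$ with $d(0)\neq0$, $h(0)=0$, $h'(0)\neq0$, $\mathcal{R}(d(t),h(t))$ is the infinite lower triangular matrix with $(n,k)$-entry $[t^n]\,d(t)h(t)^k$ ($n,k\ge0$); inverses are matrix inverses. $\mathrm{Der}(\mathcal{R}(d(t),h(t)))=\mathcal{R}(h'(t),t\,d(t))$. *)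

theory Defs
  imports "HOL-Computational_Algebra.Formal_Power_Series"
begin

unbundle fps_syntax

text \<open>
  Infinite matrices are functions of a row and a column index, both starting at 0.
\<close>

type_synonym 'a infmat = "nat \<Rightarrow> nat \<Rightarrow> 'a"

definition lower_triangular :: "'a::zero infmat \<Rightarrow> bool" where
  "lower_triangular A \<longleftrightarrow> (\<forall>n k. n < k \<longrightarrow> A n k = 0)"

definition id_mat :: "'a::zero_neq_one infmat" where
  "id_mat = (\<lambda>n k. if n = k then 1 else 0)"

text \<open>
  The sum stops at the row index \<open>n\<close>, so this is the matrix product only when the left factor
  is lower triangular; it is used in that case only.
\<close>

definition lt_mult :: "'a::semiring_0 infmat \<Rightarrow> 'a infmat \<Rightarrow> 'a infmat" where
  "lt_mult A B = (\<lambda>n k. \<Sum>j\<le>n. A n j * B j k)"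

text \<open>
  \<open>is_inverse_mat A B\<close> says that \<open>A\<close> is invertible among lower triangular matrices and that
  its inverse is \<open>B\<close>.
\<close>

definition is_inverse_mat :: "'a::{semiring_0, zero_neq_one} infmat \<Rightarrow> 'a infmat \<Rightarrow> bool" where
  "is_inverse_mat A B \<longleftrightarrow>
     lower_triangular A \<and> lower_triangular B \<and> lt_mult A B = id_mat \<and> lt_mult B A = id_mat"

definition riordan_pair :: "'a::field fps \<Rightarrow> 'a fps \<Rightarrow> bool" where
  "riordan_pair d h \<longleftrightarrow> d $ 0 \<noteq> 0 \<and> h $ 0 = 0 \<and> fps_deriv h $ 0 \<noteq> 0"

definition riordan :: "'a::field fps \<Rightarrow> 'a fps \<Rightarrow> 'a infmat" where
  "riordan d h = (\<lambda>n k. (d * h ^ k) $ n)"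

text \<open>
  \<open>Der\<close> acts on the matrix; the pair \<open>(d, h)\<close> is recovered from it, which is legitimate by
  \<open>riordan_inject\<close> below.  The value on matrices that are not Riordan arrays is unspecified.
\<close>

definition Der :: "'a::field infmat \<Rightarrow> 'a infmat" where
  "Der M = (THE N. \<exists>d h. riordan_pair d h \<and> M = riordan d h \<and>
                          N = riordan (fps_deriv h) (fps_X * d))"

lemma riordan_inject:
  assumes "riordan_pair d h" and "riordan d h = riordan d' h'"
  shows "d = d'" and "h = h'"
proof -
  have *: "d * h ^ k = d' * h' ^ k" for k
    using assms(2) by (intro fps_ext) (simp add: riordan_def fun_eq_iff)
  from *[of 0] show "d = d'" by simp
  moreover have "d \<noteq> 0" using assms(1) by (auto simp: riordan_pair_def)
  ultimately show "h = h'" using *[of 1] by simp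
qed

lemma Der_riordan:
  assumes "riordan_pair d h"
  shows "Der (riordan d h) = riordan (fps_deriv h) (fps_X * d)"
  unfolding Der_def using assms by (intro the_equality) (blast dest: riordan_inject)+

definition catalan_fps :: "'a::field_char_0 fps" where
  "catalan_fps = Abs_fps (\<lambda>n. of_nat ((2 * n) choose n) / of_nat (n + 1))"

definition Cat :: "'a::field_char_0 infmat" where
  "Cat = riordan catalan_fps (fps_X * catalan_fps)"

lemma riordan_pair_catalan: "riordan_pair catalan_fps (fps_X * catalan_fps)"
  by (simp add: riordan_pair_def catalan_fps_def)

text \<open>
  \<open>fps_sqrt1 a\<close> is the square root with constant term 1 of a series \<open>a\<close> with constant term 1.
  The first argument of \<^const>\<open>fps_radical\<close> only chooses the root of the constant term, so
  no square roots are needed in the coefficient field.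
\<close>

definition fps_sqrt1 :: "'a::field_char_0 fps \<Rightarrow> 'a fps" where
  "fps_sqrt1 a = fps_radical (\<lambda>_ _. 1) 2 a"

lemma fps_sqrt1_iff:
  assumes "a $ 0 = 1"
  shows "s = fps_sqrt1 a \<longleftrightarrow> s ^ 2 = a \<and> s $ 0 = 1"
proof -
  have "s $ 0 = 1 \<Longrightarrow> s ^ 2 = a \<longleftrightarrow> s = fps_sqrt1 a"
    using radical_unique[of "\<lambda>_ _. 1" 1 a s] assms
    by (simp add: fps_sqrt1_def numeral_2_eq_2)
  moreover have "fps_sqrt1 a $ 0 = 1" by (simp add: fps_sqrt1_def)
  ultimately show ?thesis by auto
qed

end

(*
  Write h = X C and B for the central binomial series, so that h' = B.  The recurrence of the
  central binomial coefficients is the differential equation (1 - 4X) B' = 2B, which makes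
  B^2 (1 - 4X) and 1 - 2h - (1 - 4X) B constant.  Hence the square root of 1 - 4X is 1 - 2h and
  is inverse to B, so h - h^2 = X and h is the compositional inverse of X - X^2.
  The equation h^2 = h - X turns into the Pascal recurrence for the columns B h^k.
*)
theory Submission
  imports Defs
begin

text \<open>This is the fundamental theorem of Riordan arrays: the matrix acts on the coefficient
  sequence of \<open>f\<close> as composition with \<open>h\<close> followed by multiplication by
  \<open>d\<close>.\<close>

lemma riordan_fundamental:
  assumes "h $ 0 = (0 :: 'a::field)"
  shows "(\<Sum>j\<le>n. riordan d h n j * f $ j) = (d * (f oo h)) $ n"
proof -
  \<comment> \<open>As \<open>h\<close> has no constant term, \<open>h ^ j\<close> has order at
    least \<open>j\<close>, so the terms with \<open>j > n - i\<close> vanish. The padded range no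
    longer depends on \<open>i\<close>, which allows the swap of sums.\<close>
  have compose: "(f oo h) $ (n - i) = (\<Sum>j\<le>n. f $ j * (h ^ j) $ (n - i))" for i
    unfolding fps_compose_nth using assms
    by (intro sum.mono_neutral_left) (auto simp: startsby_zero_power_prefix)
  have "(\<Sum>j\<le>n. riordan d h n j * f $ j) =
        (\<Sum>j\<le>n. \<Sum>i=0..n. d $ i * (f $ j * (h ^ j) $ (n - i)))"
    by (simp add: riordan_def fps_mult_nth sum_distrib_left sum_distrib_right mult_ac)
  also have "\<dots> = (\<Sum>i=0..n. d $ i * (f oo h) $ (n - i))"
    by (subst sum.swap) (simp add: compose sum_distrib_left)
  finally show ?thesis by (simp add: fps_mult_nth)
qed

text \<open>Column \<open>k\<close> of the right factor is the series \<open>d' * h' ^ k\<close>.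
  The fundamental theorem applies to each column, and composition with \<open>h\<close> respects
  products and powers.\<close>

lemma lt_mult_riordan:
  assumes "h $ 0 = (0 :: 'a::field)"
  shows "lt_mult (riordan d h) (riordan d' h') = riordan (d * (d' oo h)) (h' oo h)"
proof (intro ext)
  fix n k
  have "lt_mult (riordan d h) (riordan d' h') n k = (d * ((d' * h' ^ k) oo h)) $ n"
    using riordan_fundamental[OF assms, of d n "d' * h' ^ k"]
    by (simp add: lt_mult_def riordan_def)
  also have "\<dots> = riordan (d * (d' oo h)) (h' oo h) n k"
    using assms by (simp add: riordan_def fps_compose_mult_distrib fps_compose_power mult.assoc)
  finally show "lt_mult (riordan d h) (riordan d' h') n k = \<dots>" .
qed

lemma lower_triangular_riordan:
  assumes "h $ 0 = (0 :: 'a::field)"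
  shows "lower_triangular (riordan d h)"
  unfolding lower_triangular_def riordan_def fps_mult_nth
  using assms by (auto intro!: sum.neutral simp: startsby_zero_power_prefix)

lemma riordan_id: "riordan 1 fps_X = (id_mat :: 'a::field infmat)"
  by (auto simp: riordan_def id_mat_def fun_eq_iff fps_X_power_nth)

definition central_binomial_fps :: "'a::field_char_0 fps" where
  "central_binomial_fps = Abs_fps (\<lambda>n. of_nat ((2 * n) choose n))"

text \<open>Differentiation multiplies the Catalan number with index \<open>n\<close> by
  \<open>n + 1\<close>, which cancels its denominator.\<close>

lemma fps_deriv_X_catalan: "fps_deriv (fps_X * catalan_fps) = central_binomial_fps"
proof (rule fps_ext)
  fix n
  have "of_nat (n + 1) \<noteq> (0 :: 'a)" by (simp only: of_nat_eq_0_iff)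
  then show "fps_deriv (fps_X * catalan_fps) $ n = (central_binomial_fps :: 'a fps) $ n"
    by (simp add: fps_deriv_nth catalan_fps_def central_binomial_fps_def del: of_nat_Suc fps_deriv_mult)
qed

text \<open>Pascal's rule splits the central coefficient into two terms that are equal by
  symmetry.\<close>

lemma central_binomial_eq_double: "(2 * Suc n) choose Suc n = 2 * ((2 * n + 1) choose n)"
proof -
  have "(2 * n + 1) choose Suc n = (2 * n + 1) choose n"
    using binomial_symmetric[of n "2 * n + 1"] by simp
  then show ?thesis by simp
qed

lemma central_binomial_Suc:
  "Suc n * ((2 * Suc n) choose Suc n) = (4 * n + 2) * ((2 * n) choose n)"
proof -
  have "Suc n * ((2 * n + 1) choose n) = (2 * n + 1) * ((2 * n) choose n)"
    using binomial_absorb_comp[of "2 * n + 1" n] by simp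
  then show ?thesis by (simp only: central_binomial_eq_double) (simp add: algebra_simps)
qed

lemma central_binomial_ode:
  "(1 - 4 * fps_X) * fps_deriv central_binomial_fps =
     2 * (central_binomial_fps :: 'a::field_char_0 fps)"
proof (rule fps_ext)
  fix n
  let ?b = "\<lambda>n. of_nat ((2 * n) choose n) :: 'a"
  have rec: "of_nat (Suc n) * ?b (Suc n) = (4 * of_nat n + 2) * ?b n"
    using arg_cong[OF central_binomial_Suc[of n], of "of_nat :: nat \<Rightarrow> 'a"]
    by (simp only: of_nat_mult of_nat_add of_nat_numeral)
  have "((1 - 4 * fps_X) * fps_deriv central_binomial_fps) $ n =
        of_nat (Suc n) * ?b (Suc n) - 4 * (of_nat n * ?b n)"
    \<comment> \<open>The factor \<open>fps_X\<close> shifts the index, hence the case split; at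
      \<open>n = 0\<close> the subtracted term is zero.\<close>
    by (cases n) (simp_all add: central_binomial_fps_def left_diff_distrib mult.assoc
        fps_numeral_fps_const del: of_nat_Suc binomial_Suc_Suc mult_Suc_right)
  also have "\<dots> = 2 * ?b n"
    unfolding rec by (simp add: algebra_simps)
  finally show "((1 - 4 * fps_X) * fps_deriv central_binomial_fps) $ n =
      (2 * (central_binomial_fps :: 'a fps)) $ n"
    by (simp add: central_binomial_fps_def fps_numeral_fps_const)
qed

lemma fps_eq_if_deriv_eq:
  fixes f g :: "'a::{ring_1_no_zero_divisors,semiring_char_0} fps"
  assumes "fps_deriv f = fps_deriv g" and "f $ 0 = g $ 0"
  shows "f = g"
  using assms by (simp add: fps_deriv_eq_iff)

text \<open>By the differential equation the right side has derivative
  \<open>- 4 * B + 2 * B\<close>, with \<open>B\<close> the central binomial series, and both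
  constant terms are 1.\<close>

lemma one_minus_2X_catalan:
  "1 - 2 * (fps_X * catalan_fps) = (1 - 4 * fps_X) * (central_binomial_fps :: 'a::field_char_0 fps)"
proof (rule fps_eq_if_deriv_eq)
  have "fps_deriv ((1 - 4 * fps_X) * central_binomial_fps) = - 2 * (central_binomial_fps :: 'a fps)"
    using central_binomial_ode[where 'a = 'a] by (simp add: algebra_simps)
  moreover have "fps_deriv (1 - 2 * (fps_X * catalan_fps)) = - 2 * (central_binomial_fps :: 'a fps)"
    using fps_deriv_X_catalan[where 'a = 'a] by (simp add: fps_deriv_mult[of 2])
  ultimately show "fps_deriv (1 - 2 * (fps_X * catalan_fps)) =
      fps_deriv ((1 - 4 * fps_X) * (central_binomial_fps :: 'a fps))" by simp
qed (simp add: central_binomial_fps_def)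

lemma central_binomial_square:
  "central_binomial_fps ^ 2 * (1 - 4 * fps_X) = (1 :: 'a::field_char_0 fps)"
proof (rule fps_eq_if_deriv_eq)
  let ?B = "central_binomial_fps :: 'a fps"
  have "fps_deriv (?B ^ 2 * (1 - 4 * fps_X)) =
      2 * ?B * ((1 - 4 * fps_X) * fps_deriv ?B) - 4 * ?B ^ 2"
    by (simp add: power2_eq_square algebra_simps)
  also have "\<dots> = 0" by (simp add: central_binomial_ode power2_eq_square)
  finally show "fps_deriv (?B ^ 2 * (1 - 4 * fps_X)) = fps_deriv 1" by simp
qed (simp add: central_binomial_fps_def fps_nth_power_0)

lemma central_binomial_mult:
  "central_binomial_fps * (1 - 2 * (fps_X * catalan_fps)) = (1 :: 'a::field_char_0 fps)"
  using central_binomial_square[where 'a = 'a]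
  by (simp only: one_minus_2X_catalan) (simp only: power2_eq_square mult_ac)

lemma fps_sqrt1_eq: "fps_sqrt1 (1 - 4 * fps_X) = 1 - 2 * (fps_X * (catalan_fps :: 'a::field_char_0 fps))"
proof -
  let ?B = "central_binomial_fps :: 'a fps"
  have "((1 - 4 * fps_X) * ?B) ^ 2 = (1 - 4 * fps_X) * (?B ^ 2 * (1 - 4 * fps_X))"
    by (simp add: power2_eq_square mult_ac)
  then have "((1 - 4 * fps_X) * ?B) ^ 2 = 1 - 4 * fps_X"
    by (simp add: central_binomial_square)
  then show ?thesis
    using fps_sqrt1_iff[of "1 - 4 * fps_X :: 'a fps" "1 - 2 * (fps_X * catalan_fps)"]
    by (simp add: one_minus_2X_catalan central_binomial_fps_def)
qed

lemma X_catalan_square: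
  "(fps_X * catalan_fps) ^ 2 = fps_X * catalan_fps - (fps_X :: 'a::field_char_0 fps)"
proof -
  have "(1 - 2 * (fps_X * catalan_fps)) ^ 2 = 1 - 4 * (fps_X :: 'a fps)"
    using fps_sqrt1_iff[of "1 - 4 * fps_X :: 'a fps"] fps_sqrt1_eq[where 'a = 'a] by force
  then have "4 * ((fps_X * catalan_fps) ^ 2) = 4 * (fps_X * catalan_fps - (fps_X :: 'a fps))"
    by (simp add: power2_eq_square algebra_simps)
  moreover have "(4 :: 'a fps) \<noteq> 0" by simp
  ultimately show ?thesis using mult_left_cancel by blast
qed

text \<open>Substitution into the quadratic equation of \<open>X_catalan_square\<close> leaves two
  candidates, \<open>fps_X\<close> and \<open>1 - fps_X\<close>; the zero constant term rules out
  the second.\<close>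

lemma X_catalan_compose:
  "(fps_X * catalan_fps) oo (fps_X - fps_X ^ 2) = (fps_X :: 'a::field_char_0 fps)"
proof -
  let ?u = "fps_X - fps_X ^ 2 :: 'a fps"
  define g where "g = (fps_X * catalan_fps) oo ?u"
  have "g ^ 2 = g - ?u"
    using arg_cong[OF X_catalan_square, of "\<lambda>f. f oo ?u"]
    by (simp add: g_def fps_compose_power fps_compose_sub_distrib)
  then have "(g - fps_X) * (1 - g - fps_X) = 0"
    by (simp add: power2_eq_square algebra_simps)
  moreover have "(1 - g - fps_X) $ 0 = 1" by (simp add: g_def)
  then have "1 - g - fps_X \<noteq> 0" by force
  ultimately show ?thesis by (simp add: g_def)
qed

text \<open>The quadratic equation links three consecutive columns, so the induction on
  \<open>k\<close> needs two base cases.\<close>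

lemma riordan_central_binomial_nth:
  assumes "k \<le> n"
  shows "riordan central_binomial_fps (fps_X * catalan_fps) n k =
    (of_nat ((2 * n - k) choose (n - k)) :: 'a::field_char_0)"
  using assms
proof (induction k arbitrary: n rule: induct_nat_012)
  case 0
  show ?case by (simp add: riordan_def central_binomial_fps_def)
next
  case 1
  then obtain m where n: "n = Suc m" by (cases n) auto
  let ?B = "central_binomial_fps :: 'a fps"
  \<comment> \<open>Column 1 is half of \<open>?B - 1\<close>; the constant 1 does not affect row
    \<open>n\<close>, since \<open>n > 0\<close>.\<close>
  have "2 * (?B * (fps_X * catalan_fps)) = ?B - 1"
    using central_binomial_mult[where 'a = 'a] by (simp add: algebra_simps)
  then have "(2 * (?B * (fps_X * catalan_fps))) $ n = (?B - 1) $ n" by simp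
  then have "2 * riordan ?B (fps_X * catalan_fps) n 1 = ?B $ n"
    by (simp add: riordan_def fps_numeral_fps_const n)
  also have "\<dots> = 2 * of_nat ((2 * m + 1) choose m)"
    unfolding central_binomial_fps_def n fps_nth_Abs_fps central_binomial_eq_double by simp
  finally show ?case by (simp add: n)
next
  case (ge2 k)
  let ?R = "riordan central_binomial_fps (fps_X * catalan_fps) :: 'a infmat"
  from ge2.prems obtain m where n: "n = Suc (Suc (m + k))"
    by (metis add.commute add_Suc_right le_Suc_ex)
  have "b * h ^ Suc (Suc k) = b * h ^ Suc k - fps_X * (b * h ^ k)"
    if "h ^ 2 = h - fps_X" for b h :: "'a fps"
  proof -
    have "b * h ^ Suc (Suc k) = b * h ^ k * h ^ 2"
      by (simp add: power2_eq_square mult_ac)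
    then show ?thesis by (simp add: that algebra_simps)
  qed
  from this[OF X_catalan_square, of central_binomial_fps]
  \<comment> \<open>Multiplication by \<open>fps_X\<close> moves the last term up to row
    \<open>n - 1\<close>, which is \<open>Suc (m + k)\<close>.\<close>
  have "?R n (Suc (Suc k)) = ?R n (Suc k) - ?R (Suc (m + k)) k"
    unfolding riordan_def n by (simp only: fps_sub_nth fps_X_mult_nth) simp
  also have "\<dots> = of_nat ((2 * n - Suc k) choose (n - Suc k)) -
      of_nat ((2 * Suc (m + k) - k) choose (Suc (m + k) - k))"
    using ge2.IH(1)[of "Suc (m + k)"] ge2.IH(2)[of n] n by simp
  also have "\<dots> = of_nat ((2 * n - Suc (Suc k)) choose (n - Suc (Suc k)))"
  proof -
    \<comment> \<open>Expressing everything through \<open>m\<close> removes truncated subtraction,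
      and Pascal's rule becomes visible.\<close>
    have eqs: "2 * n - Suc k = Suc (2 * m + k + 2)" "n - Suc k = Suc m"
      "2 * Suc (m + k) - k = 2 * m + k + 2" "Suc (m + k) - k = Suc m"
      "2 * n - Suc (Suc k) = 2 * m + k + 2" "n - Suc (Suc k) = m"
      using n by simp_all
    show ?thesis unfolding eqs binomial_Suc_Suc by simp
  qed
  finally show ?case .
qed

lemma is_inverse_mat_riordan_central_binomial:
  "is_inverse_mat (riordan central_binomial_fps (fps_X * catalan_fps))
     (riordan (1 - 2 * fps_X) (fps_X - fps_X ^ 2) :: 'a::field_char_0 infmat)"
proof -
  let ?h = "fps_X * catalan_fps :: 'a fps" and ?B = "central_binomial_fps :: 'a fps"
  let ?u = "fps_X - fps_X ^ 2 :: 'a fps"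
  have h0: "?h $ 0 = 0" and u0: "?u $ 0 = 0" by simp_all
  have "?B * ((1 - 2 * fps_X) oo ?h) = 1"
    using central_binomial_mult[where 'a = 'a]
    by (simp add: fps_compose_sub_distrib fps_compose_mult_distrib[OF h0])
  moreover have "?u oo ?h = fps_X"
    by (simp add: fps_compose_sub_distrib fps_compose_power[OF h0, symmetric] X_catalan_square)
  ultimately have left: "lt_mult (riordan ?B ?h) (riordan (1 - 2 * fps_X) ?u) = id_mat"
    by (simp add: lt_mult_riordan[OF h0] riordan_id)
  \<comment> \<open>No direct computation of \<open>?B oo ?u\<close> is made: composing this
    identity with \<open>?u\<close> turns \<open>?h\<close> into \<open>fps_X\<close>, so
    \<open>?B oo ?u\<close> is the inverse of \<open>1 - 2 * fps_X\<close>.\<close>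
  have "(?B * (1 - 2 * ?h)) oo ?u = 1"
    by (simp add: central_binomial_mult)
  then have "(?B oo ?u) * (1 - 2 * fps_X) = 1"
    by (simp only: fps_compose_mult_distrib[OF u0, of ?B "1 - 2 * ?h"]
        fps_compose_mult_distrib[OF u0, of 2 ?h] fps_compose_sub_distrib X_catalan_compose) simp
  then have "lt_mult (riordan (1 - 2 * fps_X) ?u) (riordan ?B ?h) = id_mat"
    by (simp add: lt_mult_riordan[OF u0] riordan_id X_catalan_compose mult.commute[of "1 - 2 * fps_X"])
  with left show ?thesis
    by (simp add: is_inverse_mat_def lower_triangular_riordan)
qed

theorem theorem5p7:
  shows "Der (Cat :: 'a::field_char_0 infmat) =
           riordan (1 / fps_sqrt1 (1 - 4 * fps_X)) ((1 - fps_sqrt1 (1 - 4 * fps_X)) / 2)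
       \<and> is_inverse_mat (Der (Cat :: 'a infmat)) (riordan (1 - 2 * fps_X) (fps_X - fps_X ^ 2))
       \<and> (\<forall>n k. k \<le> n \<longrightarrow>
            Der (Cat :: 'a infmat) n k = of_nat ((2 * n - k) choose (n - k)))"
proof -
  let ?s = "1 - 2 * (fps_X * catalan_fps) :: 'a fps"
  have Der: "Der (Cat :: 'a infmat) = riordan central_binomial_fps (fps_X * catalan_fps)"
    unfolding Cat_def Der_riordan[OF riordan_pair_catalan] fps_deriv_X_catalan ..
  have "?s \<noteq> 0" using central_binomial_mult[where 'a = 'a] by force
  then have "1 / ?s = central_binomial_fps"
    using central_binomial_mult[where 'a = 'a] by (metis nonzero_mult_div_cancel_right)
  moreover have "(1 - ?s) / 2 = fps_X * catalan_fps"
    using nonzero_mult_div_cancel_left[of "2 :: 'a fps" "fps_X * catalan_fps"] by simp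
  ultimately show ?thesis
    using is_inverse_mat_riordan_central_binomial[where 'a = 'a]
    by (simp add: Der fps_sqrt1_eq riordan_central_binomial_nth)
qed

end
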